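(* Let $s$ be an integer with $1\le s\le n$ and let $\bar{x}\in\mathbb{R}^n$ be a vector. Let $A\in\mathbb{R}^{m\times n}$, let $\tau\ge 0$, and let $b=A\bar{x}+e\in\mathbb{R}^m$ with $\|e\|_2\le\tau$. Let $\delta_{3s}$ and $\delta_{4s}$ be the $3s$- and $4s$-restricted isometry constants of $A$, respectively. Let $\bar{x}_s\in\mathbb{R}^n$ be the truncated vector corresponding to the $s$ largest entries of $\bar{x}$ in absolute value. Let $\alpha>0$ and let $x^{\rm opt}$ be a minimizer of the springback-penalized problem $$\min_{x\in\mathbb{R}^n}\ \|x\|_1-\frac{\alpha}{2}\|x\|_2^2\quad\text{s.t.}\quad \|Ax-b\|_2\le\tau .$$ Suppose that $\delta_{3s}<3(1-\delta_{4s})-1$ and that $$\alpha\le\frac{\sqrt{1-\delta_{4s}}\sqrt{3s}-\sqrt{1+\delta_{3s}}\sqrt{s}}{(\sqrt{1-\delta_{4s}}+\sqrt{1+\delta_{3s}})\,\|x^{\rm opt}\|_{2}} .$$ Then $$\|x^{\rm opt}-\bar{x}\|_2\le \sqrt{\frac{2}{D_1}\tau+\frac{4}{\alpha}\|\bar{x}-\bar{x}_s\|_1},\qquad\text{where}\quad D_1=\frac{\alpha}{2}\,\frac{\sqrt{1-\delta_{4s}}+\sqrt{1+\delta_{3s}}}{\sqrt{3s}+\sqrt{s}} .$$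
   Context: The truncated vector $\bar{x}_s$ agrees with $\bar{x}$ on a set of $s$ indices at which $|\bar{x}_i|$ is largest and is zero at all other indices. For $A\in\mathbb{R}^{m\times n}$ and an index set $T\subset\{1,\dots,n\}$, $A_T\in\mathbb{R}^{m\times|T|}$ denotes the submatrix of $A$ with columns indexed by $T$. For a positive integer $k$, the $k$-restricted isometry constant of $A$ is the smallest $\delta_k\in(0,1)$ such that $(1-\delta_k)\|x\|_2^2\le\|A_Tx\|_2^2\le(1+\delta_k)\|x\|_2^2$ for all $T\subset\{1,\dots,n\}$ with $|T|\le k$ and all $x\in\mathbb{R}^{|T|}$; the existence of such constants for $k=3s$ and $k=4s$ is presupposed. Here $\|x\|_1=\sum_i|x_i|$ and $\|\cdot\|_2$ is the Euclidean norm. A minimizer means a global minimizer over the feasible set; its existence is presupposed. *)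

theory Defs
  imports "HOL-Analysis.Analysis"
begin

definition l1_norm :: "real ^ 'n \<Rightarrow> real" where
  "l1_norm x = (\<Sum>i\<in>UNIV. \<bar>x $ i\<bar>)"

text \<open>Ties in absolute value may leave several truncated vectors, so this is a relation.\<close>

definition is_truncation :: "nat \<Rightarrow> real ^ 'n \<Rightarrow> real ^ 'n \<Rightarrow> bool" where
  "is_truncation s x y \<longleftrightarrow>
     (\<exists>S. card S = s \<and> (\<forall>i\<in>S. \<forall>j\<in>- S. \<bar>x $ j\<bar> \<le> \<bar>x $ i\<bar>) \<and>
          y = (\<chi> i. if i \<in> S then x $ i else 0))"

text \<open>The product of the column submatrix \<open>A\<^sub>T\<close> with a vector whose coordinates are indexed
  by \<open>T\<close>. Such a vector is given as a function of which only the values on \<open>T\<close> are used; its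
  Euclidean norm is \<^term>\<open>L2_set x T\<close>.\<close>

definition submatrix_mult :: "real ^ 'n ^ 'm \<Rightarrow> 'n set \<Rightarrow> ('n \<Rightarrow> real) \<Rightarrow> real ^ 'm" where
  "submatrix_mult A T x = (\<Sum>j\<in>T. x j *\<^sub>R column j A)"

definition restricted_isometry :: "real ^ 'n ^ 'm \<Rightarrow> nat \<Rightarrow> real \<Rightarrow> bool" where
  "restricted_isometry A k \<delta> \<longleftrightarrow>
     (\<forall>T x. card T \<le> k \<longrightarrow>
        (1 - \<delta>) * (L2_set x T)\<^sup>2 \<le> (norm (submatrix_mult A T x))\<^sup>2 \<and>
        (norm (submatrix_mult A T x))\<^sup>2 \<le> (1 + \<delta>) * (L2_set x T)\<^sup>2)"

text \<open>The constant is required to be an attained minimum over the open interval, so it does not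
  exist for every matrix.\<close>

definition is_RIC :: "real ^ 'n ^ 'm \<Rightarrow> nat \<Rightarrow> real \<Rightarrow> bool" where
  "is_RIC A k \<delta> \<longleftrightarrow>
     \<delta> \<in> {0<..<1} \<and> restricted_isometry A k \<delta> \<and>
     (\<forall>\<delta>'\<in>{0<..<1}. restricted_isometry A k \<delta>' \<longrightarrow> \<delta> \<le> \<delta>')"

definition springback :: "real \<Rightarrow> real ^ 'n \<Rightarrow> real" where
  "springback \<alpha> x = l1_norm x - \<alpha> / 2 * (norm x)\<^sup>2"

end

theory Submission
  imports Defs
begin

text \<open>Write \<open>h = xopt - xbar\<close> and let \<open>S\<close> be the support of the truncation. Minimality of \<open>xopt\<close>
  gives the cone-type inequality
  \<open>\<parallel>h\<^sub>-\<^sub>S\<parallel>\<^sub>1 + \<alpha>/2 \<parallel>h\<parallel>\<^sup>2 \<le> \<parallel>h\<^sub>S\<parallel>\<^sub>1 + 2\<parallel>xbar - xbars\<parallel>\<^sub>1 + \<alpha> \<parallel>xopt\<parallel> \<parallel>h\<parallel>\<close>. Peeling off the complement of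
  \<open>S\<close> in blocks of \<open>3s\<close> indices of decreasing magnitude, with first block \<open>T\<close>, the remaining blocks
  have Euclidean norms summing to at most \<open>\<parallel>h\<^sub>-\<^sub>S\<parallel>\<^sub>1 / sqrt (3s)\<close>. This bounds \<open>\<parallel>h\<parallel>\<close> above and \<open>\<parallel>A h\<parallel>\<close>
  below in terms of \<open>\<parallel>h\<^bsub>S \<union> T\<^esub>\<parallel>\<close> and \<open>\<parallel>h\<^sub>-\<^sub>S\<parallel>\<^sub>1\<close>. The bound on \<open>\<alpha>\<close> is exactly what turns the right-hand
  side of the cone inequality into a multiple of the lower bound for \<open>\<parallel>A h\<parallel> \<le> 2\<tau>\<close>.\<close>

section \<open>Restriction to an index set and the restricted isometry bounds\<close>

definition vec_restrict :: "'n set \<Rightarrow> real ^ 'n \<Rightarrow> real ^ 'n" where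
  "vec_restrict T x = (\<chi> i. if i \<in> T then x $ i else 0)"

lemma vec_restrict_nth [simp]: "vec_restrict T x $ i = (if i \<in> T then x $ i else 0)"
  by (simp add: vec_restrict_def)

lemma vec_restrict_empty [simp]: "vec_restrict {} x = 0"
  by (simp add: vec_eq_iff)

lemma vec_restrict_Un_disjoint:
  assumes "T \<inter> U = {}"
  shows "vec_restrict (T \<union> U) x = vec_restrict T x + vec_restrict U x"
  using assms by (auto simp: vec_eq_iff)

lemma norm_vec_restrict: "norm (vec_restrict T x) = L2_set (\<lambda>i. x $ i) T"
proof -
  have "(\<Sum>i\<in>UNIV. (vec_restrict T x $ i)\<^sup>2) = (\<Sum>i\<in>T. (x $ i)\<^sup>2)"
    by (rule sum.mono_neutral_cong_right) auto
  then show ?thesis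
    by (simp add: norm_vec_def L2_set_def)
qed

text \<open>Padding with zeros replaces submatrices by \<open>A\<close> itself, so that restrictions
  of one vector to different index sets share a type and can be added.\<close>

lemma submatrix_mult_eq:
  "submatrix_mult A T (\<lambda>i. x $ i) = A *v vec_restrict T x"
proof -
  have "A *v vec_restrict T x = (\<Sum>j\<in>UNIV. vec_restrict T x $ j *\<^sub>R column j A)"
    by (simp add: matrix_mult_sum scalar_mult_eq_scaleR)
  also have "\<dots> = (\<Sum>j\<in>T. x $ j *\<^sub>R column j A)"
    by (rule sum.mono_neutral_cong_right) auto
  finally show ?thesis
    by (simp add: submatrix_mult_def)
qed

lemma restricted_isometry_upper:
  assumes "restricted_isometry A k \<delta>" and "card T \<le> k"
  shows "norm (A *v vec_restrict T x) \<le> sqrt (1 + \<delta>) * norm (vec_restrict T x)"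
proof -
  have "(norm (A *v vec_restrict T x))\<^sup>2 \<le> (1 + \<delta>) * (norm (vec_restrict T x))\<^sup>2"
    using assms unfolding restricted_isometry_def norm_vec_restrict submatrix_mult_eq[symmetric]
    by blast
  from real_sqrt_le_mono[OF this] show ?thesis
    by (simp add: real_sqrt_mult)
qed

lemma restricted_isometry_lower:
  assumes "restricted_isometry A k \<delta>" and "card T \<le> k"
  shows "sqrt (1 - \<delta>) * norm (vec_restrict T x) \<le> norm (A *v vec_restrict T x)"
proof -
  have "(1 - \<delta>) * (norm (vec_restrict T x))\<^sup>2 \<le> (norm (A *v vec_restrict T x))\<^sup>2"
    using assms unfolding restricted_isometry_def norm_vec_restrict submatrix_mult_eq[symmetric]
    by blast
  from real_sqrt_le_mono[OF this] show ?thesis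
    by (simp add: real_sqrt_mult)
qed

section \<open>Blocks of decreasing magnitude\<close>

lemma ex_dominating_subset:
  fixes f :: "'a \<Rightarrow> 'b::linorder"
  assumes "finite U" and "k \<le> card U"
  shows "\<exists>T\<subseteq>U. card T = k \<and> (\<forall>i\<in>T. \<forall>j\<in>U - T. f j \<le> f i)"
  using assms(2)
proof (induction k)
  case 0
  then show ?case by (intro exI[of _ "{}"]) auto
next
  case (Suc k)
  then obtain T where T: "T \<subseteq> U" "card T = k" "\<forall>i\<in>T. \<forall>j\<in>U - T. f j \<le> f i"
    by auto
  have fin: "finite (f ` (U - T))" "finite T"
    using assms(1) T(1) finite_subset by auto
  have "U - T \<noteq> {}"
    using Suc.prems T(1,2) by auto
  then have "Max (f ` (U - T)) \<in> f ` (U - T)"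
    using fin by (intro Max_in) auto
  \<comment> \<open>Greedy choice: a maximizer over \<open>U - T\<close> is dominated by
    \<open>T\<close> and dominates the rest, so adding it keeps the invariant.\<close>
  then obtain m where m: "m \<in> U - T" "f m = Max (f ` (U - T))"
    by auto
  then have "\<forall>j\<in>U - T. f j \<le> f m"
    using fin by auto
  then show ?case
    using T m fin by (intro exI[of _ "insert m T"]) auto
qed

text \<open>If \<open>U\<close> has at most \<open>k\<close> elements, it is itself the block and
  the last claim is vacuous. Otherwise take the \<open>k\<close> largest magnitudes and sum the
  domination over \<open>T\<close>.\<close>

lemma ex_leading_block:
  fixes f :: "'a \<Rightarrow> real"
  assumes "finite U"
  shows "\<exists>T\<subseteq>U. card T \<le> k \<and> (card T = k \<or> T = U) \<and>
           (\<forall>j\<in>U - T. real k * \<bar>f j\<bar> \<le> (\<Sum>i\<in>T. \<bar>f i\<bar>))"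
proof (cases "card U \<le> k")
  case True
  then show ?thesis by (intro exI[of _ U]) auto
next
  case False
  then obtain T where T: "T \<subseteq> U" "card T = k" "\<forall>i\<in>T. \<forall>j\<in>U - T. \<bar>f j\<bar> \<le> \<bar>f i\<bar>"
    using ex_dominating_subset[OF assms, of k "\<lambda>i. \<bar>f i\<bar>"] by auto
  then have "\<forall>j\<in>U - T. real k * \<bar>f j\<bar> \<le> (\<Sum>i\<in>T. \<bar>f i\<bar>)"
    using sum_bounded_below[of T _ "\<lambda>i. \<bar>f i\<bar>"] by auto
  with T show ?thesis by blast
qed

lemma L2_set_le_bounded:
  assumes "finite T" "card T \<le> k" and "\<And>i. i \<in> T \<Longrightarrow> \<bar>f i\<bar> \<le> M" and "0 \<le> M"
  shows "L2_set f T \<le> sqrt (real k) * M"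
proof -
  have "(f i)\<^sup>2 \<le> M\<^sup>2" if "i \<in> T" for i
    using assms(3)[OF that] \<open>0 \<le> M\<close> abs_le_square_iff[of "f i" M] by simp
  then have "(\<Sum>i\<in>T. (f i)\<^sup>2) \<le> real (card T) * M\<^sup>2"
    by (rule sum_bounded_above)
  also have "\<dots> \<le> real k * M\<^sup>2"
    using assms(2) by (intro mult_right_mono) auto
  finally have "L2_set f T \<le> sqrt (real k * M\<^sup>2)"
    unfolding L2_set_def by (rule real_sqrt_le_mono)
  then show ?thesis
    using \<open>0 \<le> M\<close> by (simp add: real_sqrt_mult)
qed

text \<open>Induction over the blocks: each block's entries are at most the mean magnitude of the block
  before it, so its norm is paid for by that block's \<open>\<ell>\<^sub>1\<close> mass; \<open>M\<close> pays for the first one.\<close>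

lemma norm_linear_vec_restrict_le:
  fixes f :: "real ^ 'n \<Rightarrow> 'b::real_normed_vector" and x :: "real ^ 'n"
  assumes "linear f" and "1 \<le> k" and "0 \<le> c"
    and f_le: "\<And>T. card T \<le> k \<Longrightarrow> norm (f (vec_restrict T x)) \<le> c * norm (vec_restrict T x)"
    and "\<And>i. i \<in> U \<Longrightarrow> \<bar>x $ i\<bar> \<le> M" and "0 \<le> M"
  shows "norm (f (vec_restrict U x)) \<le> c * (sqrt k * M + (\<Sum>i\<in>U. \<bar>x $ i\<bar>) / sqrt k)"
  using assms(5,6)
proof (induction "card U" arbitrary: U M rule: less_induct)
  case less
  obtain T where T: "T \<subseteq> U" "card T \<le> k" "card T = k \<or> T = U"
      "\<forall>j\<in>U - T. real k * \<bar>x $ j\<bar> \<le> (\<Sum>i\<in>T. \<bar>x $ i\<bar>)"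
    using ex_leading_block[of U k "\<lambda>i. x $ i"] by auto
  have "norm (vec_restrict T x) \<le> sqrt k * M"
    unfolding norm_vec_restrict using T less.prems by (intro L2_set_le_bounded) auto
  then have "c * norm (vec_restrict T x) \<le> c * (sqrt k * M)"
    using \<open>0 \<le> c\<close> by (rule mult_left_mono)
  with f_le[OF T(2)] have fT: "norm (f (vec_restrict T x)) \<le> c * (sqrt k * M)"
    by simp
  define T1 where "T1 = (\<Sum>i\<in>T. \<bar>x $ i\<bar>)"
  define R1 where "R1 = (\<Sum>i\<in>U - T. \<bar>x $ i\<bar>)"
  have U1: "(\<Sum>i\<in>U. \<bar>x $ i\<bar>) = T1 + R1"
    unfolding T1_def R1_def using T(1) by (subst sum.subset_diff[of T U]) auto
  have nonneg: "0 \<le> T1" "0 \<le> R1"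
    by (auto simp: T1_def R1_def intro: sum_nonneg)
  have fR: "norm (f (vec_restrict (U - T) x)) \<le> c * ((T1 + R1) / sqrt k)"
  \<comment> \<open>A block other than \<open>U\<close> has exactly \<open>k\<close> \<ge> 1
    elements, so removing it strictly shrinks the set and the induction hypothesis applies.\<close>
  proof (cases "T = U")
    case True
    then show ?thesis
      using \<open>0 \<le> c\<close> nonneg by (simp add: linear_0[OF \<open>linear f\<close>])
  next
    case False
    with T have "card T = k" by simp
    with \<open>1 \<le> k\<close> have "T \<noteq> {}" by auto
    with T(1) have "card (U - T) < card U"
      by (intro psubset_card_mono) auto
    moreover have "\<bar>x $ j\<bar> \<le> T1 / k" if "j \<in> U - T" for j
      using T(4) that \<open>1 \<le> k\<close> by (simp add: T1_def field_simps)
    ultimately have "norm (f (vec_restrict (U - T) x)) \<le> c * (sqrt k * (T1 / k) + R1 / sqrt k)"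
      unfolding R1_def using nonneg by (intro less.hyps) auto
    also have "sqrt k * (T1 / k) = T1 / sqrt k"
      using \<open>1 \<le> k\<close> by (simp add: field_simps)
    finally show ?thesis
      by (simp add: add_divide_distrib)
  qed
  have "vec_restrict U x = vec_restrict T x + vec_restrict (U - T) x"
    using vec_restrict_Un_disjoint[of T "U - T" x] T(1) by (simp add: Un_absorb1)
  then have "norm (f (vec_restrict U x))
      \<le> norm (f (vec_restrict T x)) + norm (f (vec_restrict (U - T) x))"
    by (simp add: linear_add[OF \<open>linear f\<close>] norm_triangle_ineq)
  with fT fR U1 show ?case
    by (simp add: distrib_left)
qed

text \<open>The mean magnitude on \<open>T\<close> serves as \<open>M\<close>, so \<open>T\<close>
  pays for the first block of \<open>U - T\<close>. The map \<open>f\<close> will be the identity,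
  with \<open>c = 1\<close>, and multiplication by \<open>A\<close>.\<close>

lemma norm_linear_tail_le:
  fixes f :: "real ^ 'n \<Rightarrow> 'b::real_normed_vector" and x :: "real ^ 'n"
  assumes "linear f" and "1 \<le> k" and "0 \<le> c"
    and "\<And>T. card T \<le> k \<Longrightarrow> norm (f (vec_restrict T x)) \<le> c * norm (vec_restrict T x)"
    and "T \<subseteq> U" and T: "\<forall>j\<in>U - T. real k * \<bar>x $ j\<bar> \<le> (\<Sum>i\<in>T. \<bar>x $ i\<bar>)"
  shows "norm (f (vec_restrict (U - T) x)) \<le> c * ((\<Sum>i\<in>U. \<bar>x $ i\<bar>) / sqrt k)"
proof -
  define M where "M = (\<Sum>i\<in>T. \<bar>x $ i\<bar>) / k"
  have "0 \<le> M" by (auto simp: M_def intro: sum_nonneg)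
  moreover have "\<bar>x $ j\<bar> \<le> M" if "j \<in> U - T" for j
    using T that \<open>1 \<le> k\<close> by (simp add: M_def field_simps)
  ultimately have "norm (f (vec_restrict (U - T) x))
      \<le> c * (sqrt k * M + (\<Sum>i\<in>U - T. \<bar>x $ i\<bar>) / sqrt k)"
    using assms(1-4) by (intro norm_linear_vec_restrict_le) auto
  also have "sqrt k * M = (\<Sum>i\<in>T. \<bar>x $ i\<bar>) / sqrt k"
    using \<open>1 \<le> k\<close> by (simp add: M_def field_simps)
  also have "(\<Sum>i\<in>T. \<bar>x $ i\<bar>) / sqrt k + (\<Sum>i\<in>U - T. \<bar>x $ i\<bar>) / sqrt k
      = (\<Sum>i\<in>U. \<bar>x $ i\<bar>) / sqrt k"
    using \<open>T \<subseteq> U\<close> by (subst sum.subset_diff[of T U]) (auto simp: add_divide_distrib)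
  finally show ?thesis .
qed

section \<open>The consequence of minimality\<close>

lemma springback_cone_inequality:
  fixes x y :: "real ^ 'n"
  assumes "springback \<alpha> y \<le> springback \<alpha> x" and "0 \<le> \<alpha>"
  shows "(\<Sum>i\<in>-S. \<bar>(y - x) $ i\<bar>) + \<alpha> / 2 * (norm (y - x))\<^sup>2
    \<le> (\<Sum>i\<in>S. \<bar>(y - x) $ i\<bar>) + 2 * (\<Sum>i\<in>-S. \<bar>x $ i\<bar>) + \<alpha> * (norm y * norm (y - x))"
proof -
  have split: "l1_norm z = (\<Sum>i\<in>S. \<bar>z $ i\<bar>) + (\<Sum>i\<in>-S. \<bar>z $ i\<bar>)" for z :: "real ^ 'n"
    unfolding l1_norm_def
    by (subst sum.subset_diff[of S UNIV]) (auto simp: Compl_eq_Diff_UNIV)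
  have "(\<Sum>i\<in>S. \<bar>x $ i\<bar>) - (\<Sum>i\<in>S. \<bar>(y - x) $ i\<bar>) \<le> (\<Sum>i\<in>S. \<bar>y $ i\<bar>)"
    unfolding sum_subtractf[symmetric] by (rule sum_mono) auto
  moreover have "(\<Sum>i\<in>-S. \<bar>(y - x) $ i\<bar>) - (\<Sum>i\<in>-S. \<bar>x $ i\<bar>) \<le> (\<Sum>i\<in>-S. \<bar>y $ i\<bar>)"
    unfolding sum_subtractf[symmetric] by (rule sum_mono) auto
  \<comment> \<open>Expanding around \<open>y\<close> and not \<open>x\<close> makes the linear term
    involve \<open>norm y\<close>, which for the minimizer is the quantity that the bound on
    \<alpha> controls.\<close>
  moreover have "(norm y)\<^sup>2 - (norm x)\<^sup>2 = 2 * (y \<bullet> (y - x)) - (norm (y - x))\<^sup>2"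
    by (simp add: power2_norm_eq_inner inner_diff_left inner_diff_right inner_commute)
  then have "\<alpha> / 2 * ((norm y)\<^sup>2 - (norm x)\<^sup>2)
      = \<alpha> * (y \<bullet> (y - x)) - \<alpha> / 2 * (norm (y - x))\<^sup>2"
    by (simp only:) (simp add: right_diff_distrib)
  moreover have "\<alpha> * (y \<bullet> (y - x)) \<le> \<alpha> * (norm y * norm (y - x))"
    using \<open>0 \<le> \<alpha>\<close> norm_cauchy_schwarz by (intro mult_left_mono)
  ultimately show ?thesis
    using assms(1) unfolding springback_def split by (simp add: right_diff_distrib)
qed

section \<open>The error bound\<close>

theorem theorem4p1:
  fixes A :: "real ^ 'n ^ 'm"
    and xbar xbars xopt :: "real ^ 'n"
    and b e :: "real ^ 'm"
    and s :: nat
    and \<tau> \<alpha> \<delta>3 \<delta>4 D1 :: real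
  assumes "1 \<le> s" and "s \<le> CARD('n)"
    and "0 \<le> \<tau>"
    and "b = A *v xbar + e" and "norm e \<le> \<tau>"
    and "is_RIC A (3 * s) \<delta>3" and "is_RIC A (4 * s) \<delta>4"
    and "is_truncation s xbar xbars"
    and "0 < \<alpha>"
    and "is_arg_min (springback \<alpha>) (\<lambda>x. norm (A *v x - b) \<le> \<tau>) xopt"
    and "\<delta>3 < 3 * (1 - \<delta>4) - 1"
    and "\<alpha> \<le> (sqrt (1 - \<delta>4) * sqrt (3 * real s) - sqrt (1 + \<delta>3) * sqrt (real s))
              / ((sqrt (1 - \<delta>4) + sqrt (1 + \<delta>3)) * norm xopt)"
    and "D1 = \<alpha> / 2 * ((sqrt (1 - \<delta>4) + sqrt (1 + \<delta>3)) / (sqrt (3 * real s) + sqrt (real s)))"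
  shows "norm (xopt - xbar) \<le> sqrt (2 / D1 * \<tau> + 4 / \<alpha> * l1_norm (xbar - xbars))"
proof -
  define h where "h = xopt - xbar"
  define a where "a = sqrt (1 - \<delta>4)"
  define c where "c = sqrt (1 + \<delta>3)"
  define r where "r = sqrt (real s)"
  define t where "t = sqrt (real (3 * s))"
  have "0 < a" "0 < c"
    using assms(6,7) by (auto simp: a_def c_def is_RIC_def)
  have "0 < r" "0 < t"
    using \<open>1 \<le> s\<close> by (auto simp: r_def t_def)
  have ri3: "restricted_isometry A (3 * s) \<delta>3" and ri4: "restricted_isometry A (4 * s) \<delta>4"
    using assms(6,7) by (auto simp: is_RIC_def)
  obtain S where S: "card S = s" "xbars = vec_restrict S xbar"
    using assms(8) by (auto simp: is_truncation_def vec_restrict_def)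
  define \<sigma> where "\<sigma> = l1_norm (xbar - xbars)"
  have \<sigma>: "\<sigma> = (\<Sum>i\<in>-S. \<bar>xbar $ i\<bar>)"
    unfolding \<sigma>_def l1_norm_def S(2) by (rule sum.mono_neutral_cong_right) auto
  have feasible: "norm (A *v xbar - b) \<le> \<tau>" "norm (A *v xopt - b) \<le> \<tau>"
    using assms(4,5,10) by (auto simp: is_arg_min_def)
  have "norm (A *v h) \<le> 2 * \<tau>"
    using norm_triangle_ineq4[of "A *v xopt - b" "A *v xbar - b"] feasible
    by (simp add: h_def matrix_vector_mult_diff_distrib)
  define Q where "Q = (\<Sum>i\<in>-S. \<bar>h $ i\<bar>)"
  define H where "H = norm h"
  obtain T where T: "T \<subseteq> -S" "card T \<le> 3 * s"
      "\<forall>j\<in>-S - T. real (3 * s) * \<bar>h $ j\<bar> \<le> (\<Sum>i\<in>T. \<bar>h $ i\<bar>)"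
    using ex_leading_block[of "-S" "3 * s" "\<lambda>i. h $ i"] by auto
  define P where "P = norm (vec_restrict (S \<union> T) h)"
  have h_split: "h = vec_restrict (S \<union> T) h + vec_restrict (-S - T) h"
    by (auto simp: vec_eq_iff)
  have "norm (vec_restrict (-S - T) h) \<le> 1 * (Q / t)"
    unfolding Q_def t_def using norm_linear_tail_le[of "\<lambda>x. x" "3 * s" 1 h T "-S"] T \<open>1 \<le> s\<close>
    by (auto simp: linear_ident)
  then have H_le: "H \<le> P + Q / t"
    using norm_triangle_ineq[of "vec_restrict (S \<union> T) h" "vec_restrict (-S - T) h"]
    unfolding H_def P_def h_split[symmetric] by simp
  have tail: "norm (A *v vec_restrict (-S - T) h) \<le> c * (Q / t)"
    unfolding Q_def t_def
    using T \<open>1 \<le> s\<close> \<open>0 < c\<close> restricted_isometry_upper[OF ri3]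
    by (intro norm_linear_tail_le) (auto simp: c_def)
  \<comment> \<open>The head has at most \<open>s + 3 * s\<close> indices, hence the constant of
    order \<open>4 * s\<close> here; the tail blocks used order \<open>3 * s\<close>.\<close>
  have "card (S \<union> T) \<le> 4 * s"
    using card_Un_le[of S T] S(1) T(2) by simp
  then have "a * P \<le> norm (A *v vec_restrict (S \<union> T) h)"
    unfolding a_def P_def by (rule restricted_isometry_lower[OF ri4])
  also have "\<dots> = norm (A *v h - A *v vec_restrict (-S - T) h)"
    by (subst (2) h_split) (simp add: matrix_vector_right_distrib)
  also have "\<dots> \<le> 2 * \<tau> + c * (Q / t)"
    using norm_triangle_ineq4[of "A *v h" "A *v vec_restrict (-S - T) h"] tail
      \<open>norm (A *v h) \<le> 2 * \<tau>\<close> by simp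
  finally have lower: "a * P - c * (Q / t) \<le> 2 * \<tau>"
    by simp
  \<comment> \<open>Cauchy-Schwarz against the constant 1 on the \<open>s\<close> indices of
    \<open>S\<close>.\<close>
  have "(\<Sum>i\<in>S. \<bar>h $ i\<bar>) \<le> r * L2_set (\<lambda>i. h $ i) S"
    using L2_set_mult_ineq[of "\<lambda>i. 1" "\<lambda>i. h $ i" S] S(1)
    by (simp add: r_def L2_set_def)
  also have "L2_set (\<lambda>i. h $ i) S \<le> P"
    unfolding P_def norm_vec_restrict L2_set_def
    by (intro real_sqrt_le_mono sum_mono2) auto
  finally have S_le: "(\<Sum>i\<in>S. \<bar>h $ i\<bar>) \<le> r * P"
    using \<open>0 < r\<close> by simp
  \<comment> \<open>\<open>K\<close> solves \<open>(r + K) * (- c / t) = a * (K / t - 1)\<close>: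
    exactly then is \<open>r * P - Q + K * (P + Q / t)\<close> a multiple of
    \<open>a * P - c * (Q / t)\<close> for all \<open>P\<close> and \<open>Q\<close>.\<close>
  define K where "K = (a * t - c * r) / (a + c)"
  have \<alpha>_le: "\<alpha> \<le> (a * t - c * r) / ((a + c) * norm xopt)"
    using assms(12) by (simp add: a_def c_def t_def r_def)
  \<comment> \<open>For \<open>xopt = 0\<close> the bound on \<open>\<alpha>\<close> reads \<open>\<alpha> \<le> 0\<close>, since division by zero yields zero.\<close>
  with \<open>0 < \<alpha>\<close> have "0 < norm xopt"
    by (cases "xopt = 0") auto
  with \<alpha>_le have \<alpha>K: "\<alpha> * norm xopt \<le> K"
    using \<open>0 < a\<close> \<open>0 < c\<close> by (simp add: K_def pos_le_divide_eq mult_ac)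
  then have "0 \<le> K"
    using \<open>0 < \<alpha>\<close> by (meson mult_nonneg_nonneg norm_ge_zero order.trans less_imp_le)
  have "springback \<alpha> xopt \<le> springback \<alpha> xbar"
    using assms(10) feasible(1) by (auto simp: is_arg_min_linorder)
  from springback_cone_inequality[OF this, of S]
  have "Q + \<alpha> / 2 * H\<^sup>2 \<le> (\<Sum>i\<in>S. \<bar>h $ i\<bar>) + 2 * \<sigma> + \<alpha> * norm xopt * H"
    using \<open>0 < \<alpha>\<close> unfolding Q_def H_def h_def \<sigma> by (simp add: mult.assoc)
  \<comment> \<open>Only the linear occurrence of \<open>H\<close> is replaced by its upper bound;
    the quadratic one stays on the left and yields the final estimate.\<close>
  moreover have "\<alpha> * norm xopt * H \<le> K * (P + Q / t)"
    using \<alpha>K H_le \<open>0 \<le> K\<close> by (intro mult_mono) (auto simp: H_def)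
  ultimately have "\<alpha> / 2 * H\<^sup>2 \<le> 2 * \<sigma> + (r * P - Q + K * (P + Q / t))"
    using S_le by linarith
  also have "r * P - Q + K * (P + Q / t) = (t + r) / (a + c) * (a * P - c * (Q / t))"
    using \<open>0 < a\<close> \<open>0 < c\<close> \<open>0 < t\<close> by (simp add: K_def divide_simps) (simp add: algebra_simps)
  also have "\<dots> \<le> (t + r) / (a + c) * (2 * \<tau>)"
    using lower \<open>0 < a\<close> \<open>0 < c\<close> \<open>0 < t\<close> \<open>0 < r\<close> by (intro mult_left_mono) auto
  finally have main: "\<alpha> / 2 * H\<^sup>2 \<le> 2 * \<sigma> + (t + r) / (a + c) * (2 * \<tau>)"
    by simp
  have D1: "D1 = \<alpha> / 2 * ((a + c) / (t + r))"
    using assms(13) by (simp add: a_def c_def t_def r_def)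
  have "H\<^sup>2 = 2 / \<alpha> * (\<alpha> / 2 * H\<^sup>2)"
    using \<open>0 < \<alpha>\<close> by simp
  also have "\<dots> \<le> 2 / \<alpha> * (2 * \<sigma> + (t + r) / (a + c) * (2 * \<tau>))"
    using main \<open>0 < \<alpha>\<close> by (intro mult_left_mono) auto
  also have "\<dots> = 2 / D1 * \<tau> + 4 / \<alpha> * \<sigma>"
    using \<open>0 < \<alpha>\<close> \<open>0 < a\<close> \<open>0 < c\<close> \<open>0 < t\<close> \<open>0 < r\<close>
    by (simp add: D1 add_divide_distrib) (simp add: divide_simps)
  finally show ?thesis
    unfolding H_def h_def \<sigma>_def by (rule real_le_rsqrt)
qed

end
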